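(* Let $P\subset\mathbb{R}^D$ be an $(\epsilon_1,\epsilon_2)$-significant instance of $k$-means clustering with $z$ outliers, $|P|=n$, and let $\eta,\delta,\xi\in(0,1)$. Consider the following algorithm: (1) sample a set $S$ of $\max\{\frac{3k}{\delta^2\epsilon_1}\log\frac{2k}{\eta},\frac{k}{2\xi^2\epsilon_1(1-\delta)}\log\frac{2k}{\eta}\}$ points uniformly at random from $P$; (2) let $k'=\frac{1}{\eta}\frac{\epsilon_2}{k}|S|$ and solve $(k+k')$-means clustering on $S$ using any $c$-approximation algorithm with $c\ge1$; output the set $H$ of $k+k'$ returned centers. Then with probability at least $(1-\eta)^3$, $$\Delta^{-z}_2(P,H)\le\alpha\,\Delta^{-z}_2(P,O^* )+\beta\,\xi\,\mathcal{L}^2,$$ where $\alpha=2+(4+4c)\frac{1+\delta}{1-\delta}$ and $\beta=(4+4c)\frac{1+\delta}{1-\delta}$.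
   Context: For finite $H\subset\mathbb{R}^D$, $dist(p,H)=\min_{q\in H}\|p-q\|$; for integer $0<z<n$, $\Delta^{-z}_2(P,H)=\min\{\frac{1}{|P'|}\sum_{p\in P'}dist(p,H)^2: P'\subset P,|P'|=n-z\}$. The $k$-means clustering with $z$ outliers problem asks for $k$ centers in $\mathbb{R}^D$ minimizing $\Delta^{-z}_2(P,\cdot)$. $P_{opt}\subset P$, $|P_{opt}|=n-z$, is the set of inliers of an optimal solution, and $C^*_1,\dots,C^*_k$ are the optimal clusters forming $P_{opt}$; $o^*_j$ is the mean point of $C^*_j$ and $O^*=\{o^*_1,\dots,o^*_k\}$; $\mathcal{L}=\max_{1\le j\le k}\max_{p,q\in C^*_j}\|p-q\|$. The instance is $(\epsilon_1,\epsilon_2)$-significant ($\epsilon_1,\epsilon_2>0$) if $\min_j|C^*_j|\ge\frac{\epsilon_1}{k}n$ and $z=\frac{\epsilon_2}{k}n$. A $c$-approximation for $m$-means on $S$ returns $m$ centers $H$ with $\sum_{q\in S}dist(q,H)^2$ at most $c$ times the minimum over all sets of $m$ centers in $\mathbb{R}^D$. Sampling uniformly at random means each sample point is drawn independently and uniformly from $P$ ($S$ regarded as a multiset). *)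

theory Defs
  imports "HOL-Analysis.Analysis" "HOL-Probability.Probability"
begin

definition dist_set :: "'a::euclidean_space \<Rightarrow> 'a set \<Rightarrow> real" where
  "dist_set p H = Min ((\<lambda>q. dist p q) ` H)"

definition trimmed_cost :: "'a::euclidean_space set \<Rightarrow> nat \<Rightarrow> 'a set \<Rightarrow> real" where
  "trimmed_cost P z H =
     Min {(\<Sum>p\<in>P'. (dist_set p H)\<^sup>2) / real (card P') | P'. P' \<subseteq> P \<and> card P' = card P - z}"

definition mean_point :: "'a::euclidean_space set \<Rightarrow> 'a" where
  "mean_point C = (1 / real (card C)) *\<^sub>R (\<Sum>p\<in>C. p)"

text \<open>k-means cost of a multiset of points (given as a list) w.r.t. centers H\<close>
definition kmeans_cost :: "'a::euclidean_space list \<Rightarrow> 'a set \<Rightarrow> real" where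
  "kmeans_cost S H = (\<Sum>q\<leftarrow>S. (dist_set q H)\<^sup>2)"

definition is_c_approx :: "real \<Rightarrow> nat \<Rightarrow> 'a::euclidean_space list \<Rightarrow> 'a set \<Rightarrow> bool" where
  "is_c_approx c m S H \<longleftrightarrow> finite H \<and> card H = m \<and>
     kmeans_cost S H \<le> c * (INF H'\<in>{H'. finite H' \<and> card H' = m}. kmeans_cost S H')"

text \<open>All samples of m points drawn independently uniformly from P (as lists)\<close>
definition samples :: "'a set \<Rightarrow> nat \<Rightarrow> 'a list set" where
  "samples P m = {xs. set xs \<subseteq> P \<and> length xs = m}"

definition max_diam :: "nat \<Rightarrow> (nat \<Rightarrow> 'a::euclidean_space set) \<Rightarrow> real" where
  "max_diam k C = Max (\<Union>j<k. {dist p q | p q. p \<in> C j \<and> q \<in> C j})"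

end

theory Submission
  imports Defs
begin

text \<open>
  Three events suffice: every optimal cluster \<open>C j\<close> receives at least \<open>(1 - \<delta>)\<close> times its expected
  number of sample points; the sampled inlier cost is at most \<open>(1 + \<delta>)\<close> times its expectation plus
  the corresponding multiple of \<open>\<xi> L\<^sup>2\<close>; and at most \<open>k'\<close> sample points are outliers. Under the
  last event the means of the clusters together with the sampled outliers are admissible centers
  for the sample, so the cost of \<open>H\<close> on the sample is at most \<open>c\<close> times the sampled inlier cost.
  Averaging the triangle inequality through the sample points of each cluster carries this
  over to all inliers.

  The failure probabilities must add up to at most \<open>1 - (1 - \<eta>)^3\<close>, which tends to \<open>1\<close> with \<open>\<eta>\<close>,
  so Markov's bound \<open>\<eta>\<close> for the outliers is not enough. But the number of sampled outliers is
  binomial with mean at most \<open>k'\<close>, hence exceeds \<open>k'\<close> with probability at most \<open>min \<eta> (1/2)\<close>.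
  This leaves \<open>\<eta>/2\<close> for the other two events, which are needed from one side only: the exponential moment at
  parameter \<open>\<delta>\<close> bounds the failure probability of the cost by \<open>\<eta>/(2k)\<close> and that of
  each cluster by \<open>(\<eta>/(2k))^(3/2)\<close>.
\<close>

subsection \<open>The upper tail of the binomial distribution\<close>

lemma pmf_binomial_Suc_mult:
  fixes p :: real
  assumes "0 \<le> p" "p \<le> 1"
  shows "real (Suc i) * (1 - p) * pmf (binomial_pmf n p) (Suc i)
    = (real n - real i) * p * pmf (binomial_pmf n p) i"
proof (cases "i < n")
  case True
  have "Suc i * (n choose Suc i) = (n - i) * (n choose i)"
    using binomial_absorb_comp[of n i] binomial_absorption[of i n] by simp
  then have "real (Suc i) * real (n choose Suc i) = (real n - real i) * real (n choose i)"
    using True by (metis of_nat_diff of_nat_mult less_imp_le)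
  moreover have "(1 - p) ^ (n - i) = (1 - p) * (1 - p) ^ (n - Suc i)"
    using True by (metis Suc_diff_Suc power_Suc)
  ultimately show ?thesis using assms by (simp add: mult_ac)
next
  case False
  then show ?thesis using assms by (cases "i = n") (auto simp: binomial_eq_0)
qed

lemma expectation_binomial_pmf:
  assumes "p \<in> {0..1}"
  shows "measure_pmf.expectation (binomial_pmf n p) real = real n * p"
  using sum_k_Bernstein[of n p]
  by (simp add: expectation_binomial_pmf'[OF assms] Bernstein_def mult_ac)

lemma sum_nonneg_if_weighted_sum_nonneg:
  fixes E w :: "nat \<Rightarrow> real"
  assumes mono: "mono w" and pos: "\<And>i. w i > 0"
    and crossing: "\<And>i j. E i < 0 \<Longrightarrow> i \<le> j \<Longrightarrow> E j \<le> 0"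
    and weighted: "(\<Sum>i\<le>N. w i * E i) \<ge> 0"
  shows "(\<Sum>i\<le>N. E i) \<ge> 0"
proof (cases "\<exists>i. E i < 0")
  case False
  then show ?thesis by (intro sum_nonneg) (meson not_le)
next
  case True
  then obtain c where negative: "E c < 0" and before: "\<And>i. i < c \<Longrightarrow> E i \<ge> 0"
    using exists_least_iff[of "\<lambda>i. E i < 0"] by (auto simp: not_less)
  have "w i * E i \<le> w c * E i" for i
  proof (cases "i < c")
    case True
    then show ?thesis using before by (intro mult_right_mono monoD[OF mono]) auto
  next
    case False
    then show ?thesis using crossing[OF negative] by (intro mult_right_mono_neg monoD[OF mono]) auto
  qed
  then have "(\<Sum>i\<le>N. w i * E i) \<le> w c * (\<Sum>i\<le>N. E i)"
    unfolding sum_distrib_left by (intro sum_mono)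
  then show ?thesis using weighted pos[of c] by (metis order_trans zero_le_mult_iff not_less)
qed

text \<open>Reflection of the binomial distribution at \<open>K + 1/2\<close>. The difference of the masses at
  \<open>K - i\<close> and \<open>K + 1 + i\<close> changes sign at most once, from \<open>+\<close> to \<open>-\<close>: in step \<open>i\<close> their
  quotient is multiplied by \<open>step_num i / step_den i\<close>, and this factor stays above \<open>1\<close> once it
  exceeds \<open>1\<close>, since \<open>step_num i - step_den i\<close> is affine in \<open>i\<^sup>2\<close> and negative at \<open>0\<close>.\<close>
locale binomial_reflection =
  fixes m K :: nat and p :: real
  assumes p_pos: "0 < p" and p_less_1: "p < 1"
    and mean_le: "real m * p \<le> real K" and K_less: "K < m"
begin

definition lower_mass :: "nat \<Rightarrow> real" where
  "lower_mass i = (if i \<le> K then pmf (binomial_pmf m p) (K - i) else 0)"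

definition upper_mass :: "nat \<Rightarrow> real" where
  "upper_mass i = pmf (binomial_pmf m p) (K + 1 + i)"

definition step_num :: "nat \<Rightarrow> real" where
  "step_num i = ((real m - real K)\<^sup>2 - (real i)\<^sup>2) * p\<^sup>2"

definition step_den :: "nat \<Rightarrow> real" where
  "step_den i = ((real K + 1)\<^sup>2 - (real i)\<^sup>2) * (1 - p)\<^sup>2"

lemma lower_mass_pos: "i \<le> K \<Longrightarrow> lower_mass i > 0"
  using p_pos p_less_1 K_less by (simp add: lower_mass_def)

lemma upper_mass_nonneg: "upper_mass i \<ge> 0"
  by (simp add: upper_mass_def)

lemma mean_gap: "(real m - real K) * p < (real K + 1) * (1 - p)"
  using mean_le p_less_1 by (simp add: algebra_simps)

lemma upper_mass_0_le_lower_mass_0: "upper_mass 0 \<le> lower_mass 0"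
proof -
  have "(real K + 1) * (1 - p) * upper_mass 0 = (real m - real K) * p * lower_mass 0"
    using pmf_binomial_Suc_mult[of p K m] p_pos p_less_1
    by (simp add: upper_mass_def lower_mass_def add_ac)
  also have "\<dots> \<le> (real K + 1) * (1 - p) * lower_mass 0"
    using mean_gap lower_mass_pos[of 0] by (intro mult_right_mono) auto
  finally show ?thesis using p_less_1 by simp
qed

lemma step_den_pos: "i \<le> K \<Longrightarrow> step_den i > 0"
  using p_less_1 by (simp add: step_den_def power_strict_mono)

lemma step_num_0_less_step_den_0: "step_num 0 < step_den 0"
proof -
  have "((real m - real K) * p)\<^sup>2 < ((real K + 1) * (1 - p))\<^sup>2"
    using mean_gap K_less p_pos by (intro power_strict_mono) auto
  then show ?thesis by (simp add: step_num_def step_den_def power_mult_distrib)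
qed

lemma step_den_less_step_num_mono:
  assumes "step_den i < step_num i" "i \<le> j"
  shows "step_den j < step_num j"
proof -
  have affine: "step_num i - step_den i
      = step_num 0 - step_den 0 + (real i)\<^sup>2 * ((1 - p)\<^sup>2 - p\<^sup>2)" for i
    by (simp add: step_num_def step_den_def algebra_simps)
  have "(real i)\<^sup>2 * ((1 - p)\<^sup>2 - p\<^sup>2) > 0"
    using assms(1) step_num_0_less_step_den_0 affine[of i] by linarith
  then have "(1 - p)\<^sup>2 - p\<^sup>2 > 0" by (simp add: zero_less_mult_iff)
  then have "(real i)\<^sup>2 * ((1 - p)\<^sup>2 - p\<^sup>2) \<le> (real j)\<^sup>2 * ((1 - p)\<^sup>2 - p\<^sup>2)"
    using assms(2) by (intro mult_right_mono power_mono) auto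
  then show ?thesis using assms(1) affine[of i] affine[of j] by linarith
qed

lemma step_den_mult_eq_step_num_mult:
  assumes "i < K"
  shows "step_den (Suc i) * (upper_mass (Suc i) * lower_mass i)
    = step_num (Suc i) * (upper_mass i * lower_mass (Suc i))"
proof -
  define s where "s = real (Suc i)"
  have up: "(real K + 1 + s) * (1 - p) * upper_mass (Suc i)
      = (real m - real K - s) * p * upper_mass i"
    using pmf_binomial_Suc_mult[of p "K + 1 + i" m] p_pos p_less_1
    by (simp add: upper_mass_def s_def algebra_simps)
  have "Suc (K - Suc i) = K - i" using assms by simp
  then have down: "(real K + 1 - s) * (1 - p) * lower_mass i
      = (real m - real K + s) * p * lower_mass (Suc i)"
    using pmf_binomial_Suc_mult[of p "K - Suc i" m] p_pos p_less_1 assms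
    by (simp add: lower_mass_def s_def algebra_simps of_nat_diff)
  have "step_den (Suc i) * (upper_mass (Suc i) * lower_mass i)
      = ((real K + 1 + s) * (1 - p) * upper_mass (Suc i))
        * ((real K + 1 - s) * (1 - p) * lower_mass i)"
    unfolding step_den_def s_def[symmetric] by (simp add: power2_eq_square algebra_simps)
  also have "\<dots> = step_num (Suc i) * (upper_mass i * lower_mass (Suc i))"
    unfolding up down step_num_def s_def[symmetric] by (simp add: power2_eq_square algebra_simps)
  finally show ?thesis .
qed

lemma upper_mass_Suc_le_lower_mass_Suc:
  assumes "i < K" "upper_mass i \<le> lower_mass i" "step_num (Suc i) \<le> step_den (Suc i)"
  shows "upper_mass (Suc i) \<le> lower_mass (Suc i)"
proof -
  have pos: "lower_mass i > 0" "lower_mass (Suc i) > 0" "step_den (Suc i) > 0"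
    using assms(1) by (auto intro: lower_mass_pos step_den_pos)
  have "step_den (Suc i) * (upper_mass (Suc i) * lower_mass i)
      \<le> step_den (Suc i) * (lower_mass i * lower_mass (Suc i))"
    unfolding step_den_mult_eq_step_num_mult[OF assms(1)]
    using assms pos upper_mass_nonneg[of i] by (intro mult_mono) auto
  then show ?thesis using pos by simp
qed

lemma lower_mass_Suc_less_upper_mass_Suc:
  assumes "i < K" "lower_mass i < upper_mass i" "step_den (Suc i) < step_num (Suc i)"
  shows "lower_mass (Suc i) < upper_mass (Suc i)"
proof -
  have pos: "lower_mass i > 0" "lower_mass (Suc i) > 0" "step_den (Suc i) > 0"
    using assms(1) by (auto intro: lower_mass_pos step_den_pos)
  have "step_den (Suc i) * (lower_mass i * lower_mass (Suc i))
      < step_den (Suc i) * (upper_mass (Suc i) * lower_mass i)"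
    unfolding step_den_mult_eq_step_num_mult[OF assms(1)]
    using assms pos by (intro mult_strict_mono mult_strict_right_mono) auto
  then show ?thesis using pos by simp
qed

lemma step_den_less_step_num_if_crossed:
  "i \<le> K \<Longrightarrow> lower_mass i < upper_mass i \<Longrightarrow> step_den i < step_num i"
proof (induction i)
  case 0
  then show ?case using upper_mass_0_le_lower_mass_0 by simp
next
  case (Suc i)
  show ?case
  proof (cases "lower_mass i < upper_mass i")
    case True
    then have "step_den i < step_num i" using Suc by simp
    then show ?thesis by (rule step_den_less_step_num_mono) simp
  next
    case False
    then show ?thesis
      using upper_mass_Suc_le_lower_mass_Suc[of i] Suc.prems by (meson not_less Suc_le_lessD)
  qed
qed

lemma lower_mass_less_upper_mass_mono:
  assumes "lower_mass i < upper_mass i" "i \<le> j" "j \<le> K"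
  shows "lower_mass j < upper_mass j"
  using assms(2,3)
proof (induction j rule: dec_induct)
  case base
  show ?case by (rule assms(1))
next
  case (step j)
  then have "step_den (Suc j) < step_num (Suc j)"
    using step_den_less_step_num_if_crossed[of j] step_den_less_step_num_mono[of j "Suc j"] by simp
  then show ?case using step by (intro lower_mass_Suc_less_upper_mass_Suc) auto
qed

lemma expectation_eq_sum_reflected:
  fixes f :: "nat \<Rightarrow> real"
  shows "measure_pmf.expectation (binomial_pmf m p) f
    = (\<Sum>i\<le>m. f (K - i) * lower_mass i + f (K + 1 + i) * upper_mass i)"
proof -
  define b where "b i = f i * pmf (binomial_pmf m p) i" for i
  have "measure_pmf.expectation (binomial_pmf m p) f = (\<Sum>i\<le>m. b i)"
    using p_pos p_less_1 by (simp add: expectation_binomial_pmf' b_def mult_ac)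
  also have "\<dots> = (\<Sum>i\<le>K. b i) + (\<Sum>i\<in>{K<..m}. b i)"
    using K_less by (subst sum.union_disjoint[symmetric]) (auto intro!: sum.cong)
  also have "(\<Sum>i\<le>K. b i) = (\<Sum>i\<le>K. b (K - i))"
    by (rule sum.reindex_bij_witness[of _ "\<lambda>i. K - i" "\<lambda>i. K - i"]) auto
  also have "\<dots> = (\<Sum>i\<le>m. f (K - i) * lower_mass i)"
    using K_less by (intro sum.mono_neutral_cong_left) (auto simp: lower_mass_def b_def)
  also have "(\<Sum>i\<in>{K<..m}. b i) = (\<Sum>i<m - K. b (K + 1 + i))"
    by (rule sum.reindex_bij_witness[of _ "\<lambda>i. K + 1 + i" "\<lambda>i. i - K - 1"]) auto
  also have "\<dots> = (\<Sum>i\<le>m. f (K + 1 + i) * upper_mass i)"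
    using p_pos p_less_1
    by (intro sum.mono_neutral_cong_left) (auto simp: upper_mass_def b_def binomial_eq_0)
  finally show ?thesis by (simp add: sum.distrib)
qed

lemma prob_greaterThan_le_half: "measure_pmf.prob (binomial_pmf m p) {K<..} \<le> 1 / 2"
proof -
  have p_range: "p \<in> {0..1}" using p_pos p_less_1 by simp
  have "(\<Sum>i\<le>m. (real i + 1/2) * (lower_mass i - upper_mass i))
      = measure_pmf.expectation (binomial_pmf m p) (\<lambda>i. real K + 1/2 - real i)"
    unfolding expectation_eq_sum_reflected
    by (intro sum.cong) (auto simp: lower_mass_def algebra_simps of_nat_diff)
  also have "\<dots> = real K + 1/2 - real m * p"
    using p_range by (simp add: expectation_binomial_pmf)
  finally have weighted: "(\<Sum>i\<le>m. (real i + 1/2) * (lower_mass i - upper_mass i)) \<ge> 0"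
    using mean_le by simp
  have crossing: "lower_mass j - upper_mass j \<le> 0"
    if "lower_mass i - upper_mass i < 0" "i \<le> j" for i j
    using that lower_mass_less_upper_mass_mono[of i j] upper_mass_nonneg[of j]
    by (cases "j \<le> K") (auto simp: lower_mass_def)
  have "(\<Sum>i\<le>m. lower_mass i - upper_mass i) \<ge> 0"
    by (rule sum_nonneg_if_weighted_sum_nonneg[OF _ _ crossing weighted]) (auto intro: monoI)
  moreover have "measure_pmf.prob (binomial_pmf m p) {K<..} = (\<Sum>i\<le>m. upper_mass i)"
    using expectation_eq_sum_reflected[of "indicator {K<..}"] by simp
  moreover have "(\<Sum>i\<le>m. lower_mass i) + (\<Sum>i\<le>m. upper_mass i) = 1"
    using expectation_eq_sum_reflected[of "\<lambda>_. 1"] by (simp add: sum.distrib)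
  ultimately show ?thesis by (simp add: sum_subtractf)
qed

end

lemma prob_binomial_pmf_greaterThan_le_half:
  assumes p_range: "p \<in> {0..1}" and mean: "real m * p \<le> real K"
  shows "measure_pmf.prob (binomial_pmf m p) {K<..} \<le> 1 / 2"
proof (cases "p = 0 \<or> m \<le> K")
  case True
  then have "set_pmf (binomial_pmf m p) \<inter> {K<..} = {}"
    using p_range by (auto simp: set_pmf_binomial_eq split: if_splits)
  then have "measure_pmf.prob (binomial_pmf m p) {K<..} = 0"
    by (simp only: measure_pmf_zero_iff)
  then show ?thesis by simp
next
  case False
  then have "p \<noteq> 1" using mean by auto
  then interpret binomial_reflection m K p
    using False p_range mean by unfold_locales auto
  show ?thesis by (rule prob_greaterThan_le_half)
qed

lemma prob_binomial_pmf_greaterThan_Markov: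
  assumes p_range: "p \<in> {0..1}" and "0 \<le> \<eta>" and mean: "real m * p \<le> \<eta> * real K"
  shows "measure_pmf.prob (binomial_pmf m p) {K<..} \<le> \<eta>"
proof -
  have "measure_pmf.prob (binomial_pmf m p) {K<..}
      = measure_pmf.prob (binomial_pmf m p) {i. real K + 1 \<le> real i}"
    by (intro arg_cong[where f = "measure_pmf.prob _"]) auto
  also have "\<dots> \<le> real m * p / (real K + 1)"
    using integral_Markov_inequality_measure[of "measure_pmf (binomial_pmf m p)" real UNIV
        "real K + 1"]
    by (simp add: expectation_binomial_pmf[OF p_range] integrable_binomial_pmf[OF p_range])
  also have "\<dots> \<le> \<eta>"
    using mean \<open>0 \<le> \<eta>\<close> by (simp add: divide_le_eq distrib_left)
  finally show ?thesis .
qed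

subsection \<open>Independent samples\<close>

lemma finite_samples: "finite P \<Longrightarrow> finite (samples P m)"
  unfolding samples_def by (rule finite_lists_length_eq)

lemma samples_Suc: "samples P (Suc m) = (\<lambda>(x, xs). x # xs) ` (P \<times> samples P m)"
  by (auto simp: samples_def length_Suc_conv image_iff)

lemma samples_nonempty: "P \<noteq> {} \<Longrightarrow> samples P m \<noteq> {}"
  by (induction m) (auto simp: samples_Suc, auto simp: samples_def)

lemma pair_pmf_of_set:
  assumes "finite A" "A \<noteq> {}" "finite B" "B \<noteq> {}"
  shows "pair_pmf (pmf_of_set A) (pmf_of_set B) = pmf_of_set (A \<times> B)"
proof (rule pmf_eqI)
  fix x
  show "pmf (pair_pmf (pmf_of_set A) (pmf_of_set B)) x = pmf (pmf_of_set (A \<times> B)) x"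
    using assms by (cases x) (simp add: pmf_pair indicator_times card_cartesian_product)
qed

lemma replicate_pmf_of_set:
  assumes "finite P" "P \<noteq> {}"
  shows "replicate_pmf m (pmf_of_set P) = pmf_of_set (samples P m)"
proof (induction m)
  case 0
  have "samples P 0 = {[]}" by (auto simp: samples_def)
  then show ?case by (simp add: pmf_of_set_singleton)
next
  case (Suc m)
  have "replicate_pmf (Suc m) (pmf_of_set P)
      = map_pmf (\<lambda>(x, xs). x # xs) (pair_pmf (pmf_of_set P) (replicate_pmf m (pmf_of_set P)))"
    by (simp add: pair_pmf_def map_pmf_def bind_assoc_pmf bind_return_pmf)
  also have "\<dots> = map_pmf (\<lambda>(x, xs). x # xs) (pmf_of_set (P \<times> samples P m))"
    using assms by (simp add: Suc pair_pmf_of_set finite_samples samples_nonempty)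
  also have "\<dots> = pmf_of_set (samples P (Suc m))"
    unfolding samples_Suc using assms
    by (intro map_pmf_of_set_inj) (auto simp: inj_on_def finite_samples samples_nonempty)
  finally show ?case .
qed

lemma nn_integral_replicate_pmf_prod_list:
  fixes f :: "'a \<Rightarrow> ennreal"
  shows "(\<integral>\<^sup>+xs. (\<Prod>x\<leftarrow>xs. f x) \<partial>measure_pmf (replicate_pmf m M)) = (\<integral>\<^sup>+x. f x \<partial>measure_pmf M) ^ m"
  by (induction m) (simp_all add: nn_integral_cmult nn_integral_multc)

lemma ennreal_exp_sum_list:
  "ennreal (exp (\<Sum>x\<leftarrow>xs. f x)) = (\<Prod>x\<leftarrow>xs. ennreal (exp (f x)))"
  by (induction xs) (auto simp: exp_add ennreal_mult)

lemma nn_integral_exp_le: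
  fixes f g :: "'a \<Rightarrow> real"
  assumes integrable: "integrable (measure_pmf M) g"
    and exp_le: "\<And>x. x \<in> set_pmf M \<Longrightarrow> exp (f x) \<le> 1 + g x"
  shows "(\<integral>\<^sup>+x. ennreal (exp (f x)) \<partial>measure_pmf M) \<le> ennreal (exp (measure_pmf.expectation M g))"
proof -
  have nonneg: "1 + g x \<ge> 0" if "x \<in> set_pmf M" for x
    using exp_le[OF that] exp_ge_zero[of "f x"] by linarith
  have "(\<integral>\<^sup>+x. ennreal (exp (f x)) \<partial>measure_pmf M) \<le> (\<integral>\<^sup>+x. ennreal (1 + g x) \<partial>measure_pmf M)"
    using exp_le by (intro nn_integral_mono_AE) (auto simp: AE_measure_pmf_iff intro: ennreal_leI)
  also have "\<dots> = ennreal (measure_pmf.expectation M (\<lambda>x. 1 + g x))"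
    using integrable nonneg by (intro nn_integral_eq_integral) (auto simp: AE_measure_pmf_iff)
  also have "\<dots> = ennreal (1 + measure_pmf.expectation M g)" using integrable by simp
  also have "\<dots> \<le> ennreal (exp (measure_pmf.expectation M g))"
    by (intro ennreal_leI exp_ge_add_one_self)
  finally show ?thesis .
qed

lemma prob_replicate_pmf_sum_list_ge_Chernoff:
  fixes f g :: "'a \<Rightarrow> real"
  assumes "integrable (measure_pmf M) g" and "\<And>x. x \<in> set_pmf M \<Longrightarrow> exp (f x) \<le> 1 + g x"
  shows "measure_pmf.prob (replicate_pmf m M) {xs. t \<le> (\<Sum>x\<leftarrow>xs. f x)}
    \<le> exp (real m * measure_pmf.expectation M g - t)"
proof -
  have "emeasure (measure_pmf (replicate_pmf m M)) {xs. t \<le> (\<Sum>x\<leftarrow>xs. f x)}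
      \<le> ennreal (exp (- t)) * (\<integral>\<^sup>+xs. ennreal (exp (\<Sum>x\<leftarrow>xs. f x)) \<partial>measure_pmf (replicate_pmf m M))"
    using Chernoff_ineq_nn_integral_ge[of 1 UNIV "measure_pmf (replicate_pmf m M)"
        "\<lambda>xs. \<Sum>x\<leftarrow>xs. f x" t]
    by simp
  also have "\<dots> = ennreal (exp (- t)) * (\<integral>\<^sup>+x. ennreal (exp (f x)) \<partial>measure_pmf M) ^ m"
    by (simp only: ennreal_exp_sum_list nn_integral_replicate_pmf_prod_list)
  also have "\<dots> \<le> ennreal (exp (- t)) * ennreal (exp (measure_pmf.expectation M g)) ^ m"
    by (intro mult_left_mono power_mono nn_integral_exp_le assms) auto
  also have "\<dots> = ennreal (exp (real m * measure_pmf.expectation M g - t))"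
    by (simp add: ennreal_power exp_diff exp_minus divide_inverse mult.commute
        flip: ennreal_mult exp_of_nat_mult)
  finally show ?thesis by (simp add: measure_pmf.emeasure_eq_measure)
qed

lemma exp_minus_le_quadratic:
  fixes x :: real
  assumes "0 \<le> x"
  shows "exp (- x) \<le> 1 - x + x\<^sup>2 / 2"
proof -
  define F where "F x = 1 - x + x\<^sup>2 / 2 - exp (- x)" for x :: real
  have "F 0 \<le> F x"
  proof (rule DERIV_nonneg_imp_nondecreasing[OF assms])
    fix y :: real
    have "(F has_real_derivative (- 1 + y + exp (- y))) (at y)"
      unfolding F_def by (auto intro!: derivative_eq_intros)
    moreover have "- 1 + y + exp (- y) \<ge> 0" using exp_ge_add_one_self[of "- y"] by simp
    ultimately show "\<exists>d. (F has_real_derivative d) (at y) \<and> 0 \<le> d" by blast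
  qed
  then show ?thesis by (simp add: F_def)
qed

lemma exp_minus_mult_le_linear:
  fixes \<delta> y :: real
  assumes "0 \<le> \<delta>" "0 \<le> y" "y \<le> 1"
  shows "exp (- \<delta> * y) \<le> 1 + - (\<delta> - \<delta>\<^sup>2 / 2) * y"
proof -
  have "exp (- (\<delta> * y)) \<le> 1 - \<delta> * y + (\<delta> * y)\<^sup>2 / 2"
    using assms by (intro exp_minus_le_quadratic) auto
  moreover have "(\<delta> * y)\<^sup>2 \<le> \<delta>\<^sup>2 * y"
    using assms unfolding power_mult_distrib
    by (intro mult_left_mono) (auto simp: power2_eq_square mult_left_le)
  ultimately show ?thesis by (simp add: algebra_simps)
qed

lemma exp_mult_le_linear:
  fixes \<delta> y :: real
  assumes "0 \<le> \<delta>" "\<delta> \<le> 1" "0 \<le> y" "y \<le> 1"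
  shows "exp (\<delta> * y) \<le> 1 + (\<delta> + \<delta>\<^sup>2) * y"
proof -
  have "exp (\<delta> * y) \<le> 1 + \<delta> * y + (\<delta> * y)\<^sup>2"
    using assms by (intro exp_bound) (auto intro: mult_le_one)
  moreover have "(\<delta> * y)\<^sup>2 \<le> \<delta>\<^sup>2 * y"
    using assms unfolding power_mult_distrib
    by (intro mult_left_mono) (auto simp: power2_eq_square mult_left_le)
  ultimately show ?thesis by (simp add: algebra_simps)
qed

lemma integrable_measure_pmf_bounded:
  fixes g :: "'a \<Rightarrow> real"
  assumes "\<And>x. x \<in> set_pmf M \<Longrightarrow> 0 \<le> g x \<and> g x \<le> R"
  shows "integrable (measure_pmf M) g"
  using assms
  by (intro measure_pmf.integrable_const_bound[where B = R]) (auto simp: AE_measure_pmf_iff)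

lemma prob_replicate_pmf_lower_tail:
  fixes g :: "'a \<Rightarrow> real" and \<delta> :: real and m :: nat
  assumes \<delta>_nonneg: "0 \<le> \<delta>" and g_bounds: "\<And>x. x \<in> set_pmf M \<Longrightarrow> 0 \<le> g x \<and> g x \<le> 1"
  defines "\<mu> \<equiv> real m * measure_pmf.expectation M g"
  shows "measure_pmf.prob (replicate_pmf m M) {xs. (\<Sum>x\<leftarrow>xs. g x) < (1 - \<delta>) * \<mu>}
    \<le> exp (- (\<delta>\<^sup>2 * \<mu> / 2))"
proof -
  let ?scaled = "{xs. - \<delta> * ((1 - \<delta>) * \<mu>) \<le> (\<Sum>x\<leftarrow>xs. - \<delta> * g x)}"
  have "{xs. (\<Sum>x\<leftarrow>xs. g x) < (1 - \<delta>) * \<mu>} \<subseteq> ?scaled"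
    unfolding sum_list_const_mult using \<delta>_nonneg by (auto intro!: mult_left_mono)
  then have "measure_pmf.prob (replicate_pmf m M) {xs. (\<Sum>x\<leftarrow>xs. g x) < (1 - \<delta>) * \<mu>}
      \<le> measure_pmf.prob (replicate_pmf m M) ?scaled"
    by (rule measure_pmf.finite_measure_mono) simp
  also have "\<dots> \<le> exp (real m * measure_pmf.expectation M (\<lambda>x. - (\<delta> - \<delta>\<^sup>2 / 2) * g x)
      - - \<delta> * ((1 - \<delta>) * \<mu>))"
    using g_bounds \<delta>_nonneg exp_minus_mult_le_linear
    by (intro prob_replicate_pmf_sum_list_ge_Chernoff integrable_mult_right
        integrable_measure_pmf_bounded[of M g 1]) auto
  also have "\<dots> = exp (- (\<delta>\<^sup>2 * \<mu> / 2))"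
    unfolding integral_mult_right_zero \<mu>_def by (simp add: algebra_simps power2_eq_square)
  finally show ?thesis .
qed

lemma prob_replicate_pmf_upper_tail:
  fixes g :: "'a \<Rightarrow> real" and \<delta> t R :: real and m :: nat
  assumes \<delta>_bounds: "0 \<le> \<delta>" "\<delta> \<le> 1" and R_pos: "0 < R"
    and g_bounds: "\<And>x. x \<in> set_pmf M \<Longrightarrow> 0 \<le> g x \<and> g x \<le> R"
  defines "\<mu> \<equiv> real m * measure_pmf.expectation M g"
  shows "measure_pmf.prob (replicate_pmf m M) {xs. (1 + \<delta>) * \<mu> + R * t < (\<Sum>x\<leftarrow>xs. g x)}
    \<le> exp (- (\<delta> * t))"
proof -
  let ?scaled = "{xs. \<delta> / R * ((1 + \<delta>) * \<mu> + R * t) \<le> (\<Sum>x\<leftarrow>xs. \<delta> / R * g x)}"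
  have exp_le: "exp (\<delta> / R * g x) \<le> 1 + (\<delta> + \<delta>\<^sup>2) / R * g x" if "x \<in> set_pmf M" for x
    using exp_mult_le_linear[of \<delta> "g x / R"] g_bounds[OF that] \<delta>_bounds R_pos by simp
  have "{xs. (1 + \<delta>) * \<mu> + R * t < (\<Sum>x\<leftarrow>xs. g x)} \<subseteq> ?scaled"
    unfolding sum_list_const_mult using \<delta>_bounds R_pos
    by (auto intro!: mult_left_mono divide_right_mono)
  then have "measure_pmf.prob (replicate_pmf m M) {xs. (1 + \<delta>) * \<mu> + R * t < (\<Sum>x\<leftarrow>xs. g x)}
      \<le> measure_pmf.prob (replicate_pmf m M) ?scaled"
    by (rule measure_pmf.finite_measure_mono) simp
  also have "\<dots> \<le> exp (real m * measure_pmf.expectation M (\<lambda>x. (\<delta> + \<delta>\<^sup>2) / R * g x)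
      - \<delta> / R * ((1 + \<delta>) * \<mu> + R * t))"
    using g_bounds exp_le by (intro prob_replicate_pmf_sum_list_ge_Chernoff integrable_mult_right
        integrable_measure_pmf_bounded[of M g R]) auto
  also have "\<dots> = exp (- (\<delta> * t))"
    using R_pos unfolding integral_mult_right_zero \<mu>_def by (simp add: field_simps power2_eq_square)
  finally show ?thesis .
qed

lemma map_pmf_mem_eq_bernoulli: "map_pmf (\<lambda>x. x \<in> B) M = bernoulli_pmf (measure_pmf.prob M B)"
proof (rule pmf_eqI)
  fix b
  have "measure_pmf.prob M (- B) = 1 - measure_pmf.prob M B"
    using measure_pmf.prob_compl[of B M] by (simp add: Compl_eq_Diff_UNIV)
  then show "pmf (map_pmf (\<lambda>x. x \<in> B) M) b = pmf (bernoulli_pmf (measure_pmf.prob M B)) b"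
    by (cases b) (auto simp: pmf_map vimage_def Compl_eq)
qed

lemma replicate_pmf_map: "replicate_pmf m (map_pmf f M) = map_pmf (map f) (replicate_pmf m M)"
  by (induction m) (simp_all add: map_pmf_def bind_assoc_pmf bind_return_pmf)

lemma map_pmf_count_replicate_pmf:
  "map_pmf (\<lambda>xs. length (filter (\<lambda>x. x \<in> B) xs)) (replicate_pmf m M)
    = binomial_pmf m (measure_pmf.prob M B)"
  by (simp add: binomial_pmf_altdef measure_pmf.prob_le_1 replicate_pmf_map pmf.map_comp comp_def
      filter_map length_map flip: map_pmf_mem_eq_bernoulli)

lemma prob_mono_on_set_pmf:
  assumes "\<And>x. x \<in> set_pmf M \<Longrightarrow> x \<in> A \<Longrightarrow> x \<in> B"
  shows "measure_pmf.prob M A \<le> measure_pmf.prob M B"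
  using assms by (intro measure_pmf.finite_measure_mono_AE) (auto simp: AE_measure_pmf_iff)

lemma prob_bind_pmf_ge:
  assumes "\<And>x y. x \<in> set_pmf M \<Longrightarrow> x \<in> G \<Longrightarrow> y \<in> set_pmf (A x) \<Longrightarrow> y \<in> E"
  shows "measure_pmf.prob M G \<le> measure_pmf.prob (bind_pmf M A) E"
proof -
  have "emeasure (measure_pmf M) G = (\<integral>\<^sup>+x. indicator G x \<partial>measure_pmf M)" by simp
  also have "\<dots> \<le> (\<integral>\<^sup>+x. emeasure (measure_pmf (A x)) E \<partial>measure_pmf M)"
  proof (rule nn_integral_mono_AE, unfold AE_measure_pmf_iff, intro ballI)
    fix x assume in_support: "x \<in> set_pmf M"
    show "indicator G x \<le> emeasure (measure_pmf (A x)) E"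
    proof (cases "x \<in> G")
      case True
      then have "emeasure (measure_pmf (A x)) E = 1"
        using assms[OF in_support True]
        by (intro measure_pmf.emeasure_eq_1_AE) (auto simp: AE_measure_pmf_iff)
      then show ?thesis by (simp add: indicator_def)
    qed simp
  qed
  also have "\<dots> = emeasure (measure_pmf (bind_pmf M A)) E" by simp
  finally show ?thesis by (simp add: measure_pmf.emeasure_eq_measure)
qed

subsection \<open>Clustering costs\<close>

lemma dist_set_eq_infdist:
  assumes "finite H" "H \<noteq> {}"
  shows "dist_set p H = infdist p H"
  using assms by (simp add: dist_set_def infdist_notempty cInf_eq_Min)

lemma dist_set_sq_le:
  assumes "finite H" "H \<noteq> {}"
  shows "(dist_set p H)\<^sup>2 \<le> 2 * (dist p q)\<^sup>2 + 2 * (dist_set q H)\<^sup>2"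
proof -
  have "(dist_set p H)\<^sup>2 \<le> (dist p q + dist_set q H)\<^sup>2"
    using infdist_triangle[of p H q] infdist_nonneg[of p H]
    by (intro power_mono) (auto simp: dist_set_eq_infdist assms)
  also have "\<dots> \<le> 2 * (dist p q)\<^sup>2 + 2 * (dist_set q H)\<^sup>2"
    using zero_le_power2[of "dist p q - dist_set q H"] by (simp add: power2_eq_square algebra_simps)
  finally show ?thesis .
qed

lemma kmeans_cost_nonneg: "0 \<le> kmeans_cost S H"
  unfolding kmeans_cost_def by (intro sum_list_nonneg) auto

lemma kmeans_cost_antimono:
  assumes "A \<subseteq> B" "A \<noteq> {}" "finite B"
  shows "kmeans_cost S B \<le> kmeans_cost S A"
proof -
  have "finite A" "B \<noteq> {}" using assms finite_subset by auto
  then show ?thesis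
    unfolding kmeans_cost_def using assms
    by (intro sum_list_mono power_mono)
      (simp_all add: dist_set_eq_infdist infdist_mono infdist_nonneg)
qed

lemma kmeans_cost_c_approx_le:
  fixes H :: "'a::euclidean_space set"
  assumes approx: "is_c_approx c M S H" and c_nonneg: "0 \<le> c"
    and "finite A" and "A \<noteq> {}" and "card A \<le> M"
  shows "kmeans_cost S H \<le> c * kmeans_cost S A"
proof -
  have "infinite (UNIV :: 'a set)"
    using finite_imp_not_open[of "UNIV :: 'a set"] by auto
  then have "infinite (- A)" using \<open>finite A\<close> by (metis finite_compl Compl_eq_Diff_UNIV)
  then obtain B where extra: "B \<subseteq> - A" "finite B" "card B = M - card A"
    using infinite_arbitrarily_large by blast
  have "card (A \<union> B) = card A + card B"
    using \<open>finite A\<close> extra by (intro card_Un_disjoint) auto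
  then have padded: "finite (A \<union> B)" "card (A \<union> B) = M"
    using \<open>finite A\<close> \<open>card A \<le> M\<close> extra by auto
  have "(INF X\<in>{X. finite X \<and> card X = M}. kmeans_cost S X) \<le> kmeans_cost S (A \<union> B)"
    using padded kmeans_cost_nonneg by (intro cINF_lower) (auto intro!: bdd_belowI)
  also have "\<dots> \<le> kmeans_cost S A"
    using \<open>A \<noteq> {}\<close> padded by (intro kmeans_cost_antimono) auto
  finally show ?thesis
    using approx c_nonneg unfolding is_c_approx_def by (meson mult_left_mono order_trans)
qed

lemma trimmed_cost_le:
  assumes "finite P" "P' \<subseteq> P" "card P' = card P - z"
  shows "trimmed_cost P z H \<le> (\<Sum>p\<in>P'. (dist_set p H)\<^sup>2) / real (card P')"
  unfolding trimmed_cost_def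
proof (rule Min_le)
  let ?costs = "{(\<Sum>p\<in>P'. (dist_set p H)\<^sup>2) / real (card P') | P'. P' \<subseteq> P \<and> card P' = card P - z}"
  have "?costs \<subseteq> (\<lambda>P'. (\<Sum>p\<in>P'. (dist_set p H)\<^sup>2) / real (card P')) ` Pow P" by auto
  then show "finite ?costs"
    using assms(1) by (meson finite_Pow_iff finite_imageI finite_subset)
qed (use assms in blast)

lemma sum_dist_sq_eq_mean_point:
  fixes C :: "'a::euclidean_space set"
  assumes "finite C"
  shows "(\<Sum>p\<in>C. (dist p a)\<^sup>2)
    = (\<Sum>p\<in>C. (dist p (mean_point C))\<^sup>2) + real (card C) * (dist (mean_point C) a)\<^sup>2"
proof (cases "C = {}")
  case False
  define \<mu> where "\<mu> = mean_point C"
  have "real (card C) > 0" using False assms by (simp add: card_gt_0_iff)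
  then have centered: "(\<Sum>p\<in>C. p - \<mu>) = 0"
    by (simp add: sum_subtractf \<mu>_def mean_point_def sum_constant_scaleR)
  have expand: "(dist p a)\<^sup>2 = (dist p \<mu>)\<^sup>2 + (2 * ((p - \<mu>) \<bullet> (\<mu> - a)) + (dist \<mu> a)\<^sup>2)" for p
    unfolding dist_norm power2_norm_eq_inner by (simp add: inner_commute algebra_simps)
  have "(\<Sum>p\<in>C. (dist p a)\<^sup>2)
      = (\<Sum>p\<in>C. (dist p \<mu>)\<^sup>2 + (2 * ((p - \<mu>) \<bullet> (\<mu> - a)) + (dist \<mu> a)\<^sup>2))"
    by (intro sum.cong refl expand)
  also have "\<dots> = (\<Sum>p\<in>C. (dist p \<mu>)\<^sup>2)
      + (2 * ((\<Sum>p\<in>C. p - \<mu>) \<bullet> (\<mu> - a)) + real (card C) * (dist \<mu> a)\<^sup>2)"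
    by (simp only: sum.distrib inner_sum_left sum_distrib_left sum_constant)
  finally show ?thesis unfolding centered by (simp add: \<mu>_def)
qed simp

lemma mean_point_in_convex:
  assumes "finite C" "C \<noteq> {}" "convex D" "C \<subseteq> D"
  shows "mean_point C \<in> D"
proof -
  have "(\<Sum>p\<in>C. (1 / real (card C)) *\<^sub>R p) \<in> D"
    using assms by (intro convex_sum) auto
  then show ?thesis by (simp add: mean_point_def scaleR_right.sum)
qed

lemma sum_sum_list_filter_disjoint_family_le:
  fixes f :: "'a \<Rightarrow> real"
  assumes disjoint: "finite I" "disjoint_family_on C I" and nonneg: "\<And>x. 0 \<le> f x"
  shows "(\<Sum>i\<in>I. \<Sum>x\<leftarrow>filter (\<lambda>x. x \<in> C i) xs. f x) \<le> (\<Sum>x\<leftarrow>xs. f x)"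
proof -
  have "(\<Sum>x\<leftarrow>filter (\<lambda>x. x \<in> B) xs. f x) = (\<Sum>x\<leftarrow>xs. indicat_real B x * f x)" for B
    by (induction xs) auto
  then have "(\<Sum>i\<in>I. \<Sum>x\<leftarrow>filter (\<lambda>x. x \<in> C i) xs. f x)
      = (\<Sum>i\<in>I. \<Sum>x\<leftarrow>xs. indicat_real (C i) x * f x)" by simp
  also have "\<dots> = (\<Sum>x\<leftarrow>xs. (\<Sum>i\<in>I. indicat_real (C i) x) * f x)"
    by (induction xs) (auto simp: sum.distrib sum_distrib_right)
  also have "\<dots> \<le> (\<Sum>x\<leftarrow>xs. f x)"
    unfolding indicator_UN_disjoint[OF disjoint, symmetric] using nonneg
    by (intro sum_list_mono) (simp add: indicator_def)
  finally show ?thesis .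
qed

text \<open>The distance of \<open>a\<close> to \<open>H\<close> is averaged over the sample points in \<open>B\<close>.\<close>
lemma sum_dist_set_sq_le_sample:
  fixes a :: "'a::euclidean_space"
  assumes centers: "finite H" "H \<noteq> {}" and \<kappa>_pos: "\<kappa> > 0"
    and many: "\<kappa> * real (card B) \<le> real (length (filter (\<lambda>x. x \<in> B) S))"
  shows "(\<Sum>p\<in>B. (dist_set p H)\<^sup>2) \<le> 2 * (\<Sum>p\<in>B. (dist p a)\<^sup>2)
    + 4 / \<kappa> * (\<Sum>x\<leftarrow>filter (\<lambda>x. x \<in> B) S. (dist x a)\<^sup>2 + (dist_set x H)\<^sup>2)"
proof -
  let ?SB = "filter (\<lambda>x. x \<in> B) S" and ?d = "(dist_set a H)\<^sup>2"
  have "\<kappa> * (real (card B) * ?d) \<le> real (length ?SB) * ?d"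
    using mult_right_mono[OF many, of ?d] by (simp add: mult.assoc)
  also have "\<dots> = (\<Sum>x\<leftarrow>?SB. ?d)" by (simp add: sum_list_triv)
  also have "\<dots> \<le> (\<Sum>x\<leftarrow>?SB. 2 * ((dist x a)\<^sup>2 + (dist_set x H)\<^sup>2))"
    using dist_set_sq_le[OF centers, of a] by (intro sum_list_mono) (simp add: dist_commute)
  finally have average: "real (card B) * ?d \<le> 2 / \<kappa> * (\<Sum>x\<leftarrow>?SB. (dist x a)\<^sup>2 + (dist_set x H)\<^sup>2)"
    using \<kappa>_pos by (simp only: sum_list_const_mult) (simp add: field_simps)
  have "(\<Sum>p\<in>B. (dist_set p H)\<^sup>2) \<le> (\<Sum>p\<in>B. 2 * (dist p a)\<^sup>2 + 2 * ?d)"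
    by (intro sum_mono dist_set_sq_le centers)
  also have "\<dots> = 2 * (\<Sum>p\<in>B. (dist p a)\<^sup>2) + 2 * (real (card B) * ?d)"
    by (simp add: sum.distrib sum_distrib_left)
  finally show ?thesis using average by simp
qed

subsection \<open>Samples of a clustered point set with outliers\<close>

lemma exp_minus_three_halves_ln:
  fixes x :: real
  assumes "0 < x"
  shows "exp (- (3 / 2 * ln x)) = 1 / (x * sqrt x)"
proof -
  have "exp (3 / 2 * ln x) = exp (ln x) * exp (1 / 2 * ln x)" by (simp flip: exp_add)
  also have "\<dots> = x * sqrt x" using assms powr_half_sqrt[of x] by (simp add: powr_def)
  finally show ?thesis by (simp add: exp_minus inverse_eq_divide)
qed

lemma failure_budget_le:
  fixes \<eta> :: real
  assumes "0 < \<eta>" "\<eta> < 1"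
  shows "\<eta> / 2 + min \<eta> (1 / 2) \<le> 1 - (1 - \<eta>) ^ 3"
proof (cases "\<eta> \<le> 1 / 2")
  case True
  have "\<eta> * (3 / 2) \<le> \<eta> * (3 - 3 * \<eta> + \<eta>\<^sup>2)"
    using True assms zero_le_power2[of \<eta>] by (intro mult_left_mono) linarith+
  then show ?thesis using True by (simp add: power3_eq_cube power2_eq_square algebra_simps)
next
  case False
  have "(1 - \<eta>)\<^sup>2 \<le> (1 / 2)\<^sup>2" using False assms by (intro power_mono) auto
  then have "(1 - \<eta>) * (1 - \<eta>)\<^sup>2 \<le> (1 - \<eta>) * (1 / 2)"
    using assms by (intro mult_left_mono) (auto simp: power2_eq_square)
  then show ?thesis using False by (simp add: power3_eq_cube power2_eq_square)
qed

locale disjoint_clusters =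
  fixes P :: "'a::euclidean_space set" and k :: nat and C :: "nat \<Rightarrow> 'a set"
  assumes finite_P: "finite P" and k_pos: "0 < k"
    and cluster_subset: "j < k \<Longrightarrow> C j \<subseteq> P" and cluster_nonempty: "j < k \<Longrightarrow> C j \<noteq> {}"
    and disjoint: "disjoint_family_on C {..<k}"
begin

definition inliers :: "'a set" where
  "inliers = (\<Union>j<k. C j)"

definition sq_dist_to_mean :: "'a \<Rightarrow> real" where
  "sq_dist_to_mean x = (\<Sum>j<k. indicat_real (C j) x * (dist x (mean_point (C j)))\<^sup>2)"

definition inlier_cost :: real where
  "inlier_cost = (\<Sum>p\<in>inliers. sq_dist_to_mean p)"

definition expected_count :: "nat \<Rightarrow> nat \<Rightarrow> real" where
  "expected_count m j = real m / real (card P) * real (card (C j))"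

definition undersampled :: "real \<Rightarrow> nat \<Rightarrow> 'a list \<Rightarrow> bool" where
  "undersampled \<delta> j S \<longleftrightarrow>
     real (length (filter (\<lambda>x. x \<in> C j) S)) < (1 - \<delta>) * expected_count (length S) j"

definition cost_slack :: "real \<Rightarrow> real \<Rightarrow> nat \<Rightarrow> real" where
  "cost_slack \<delta> \<xi> m = (1 + \<delta>) * (real m / real (card P) * (real (card inliers) * \<xi>))"

definition costly :: "real \<Rightarrow> real \<Rightarrow> 'a list \<Rightarrow> bool" where
  "costly \<delta> \<xi> S \<longleftrightarrow> (1 + \<delta>) * (real (length S) / real (card P) * inlier_cost)
     + (max_diam k C)\<^sup>2 * cost_slack \<delta> \<xi> (length S) < (\<Sum>x\<leftarrow>S. sq_dist_to_mean x)"

definition outlier_count :: "'a list \<Rightarrow> nat" where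
  "outlier_count S = length (filter (\<lambda>x. x \<notin> inliers) S)"

definition representative :: "real \<Rightarrow> real \<Rightarrow> nat \<Rightarrow> 'a list \<Rightarrow> bool" where
  "representative \<delta> \<xi> K S \<longleftrightarrow>
     (\<forall>j<k. \<not> undersampled \<delta> j S) \<and> \<not> costly \<delta> \<xi> S \<and> outlier_count S \<le> K"

lemma inliers_subset: "inliers \<subseteq> P"
  using cluster_subset by (auto simp: inliers_def)

lemma finite_cluster: "j < k \<Longrightarrow> finite (C j)"
  using cluster_subset finite_P finite_subset by blast

lemma finite_inliers: "finite inliers"
  using inliers_subset finite_P finite_subset by blast

lemma card_inliers: "card inliers = (\<Sum>j<k. card (C j))"
  unfolding inliers_def using finite_cluster disjoint
  by (intro card_UN_disjoint) (auto simp: disjoint_family_on_def)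

lemma card_inliers_pos: "card inliers > 0"
  using k_pos cluster_nonempty[of 0] finite_inliers by (auto simp: card_gt_0_iff inliers_def)

lemma P_nonempty: "P \<noteq> {}"
  using card_inliers_pos inliers_subset by auto

lemma card_P_pos: "card P > 0"
  using P_nonempty finite_P by (simp add: card_gt_0_iff)

lemma sum_inliers: "(\<Sum>p\<in>inliers. f p) = (\<Sum>j<k. \<Sum>p\<in>C j. f p)"
  unfolding inliers_def using finite_cluster disjoint
  by (intro sum.UNION_disjoint) (auto simp: disjoint_family_on_def)

lemma sq_dist_to_mean_cluster:
  assumes "j < k" "x \<in> C j"
  shows "sq_dist_to_mean x = (dist x (mean_point (C j)))\<^sup>2"
proof -
  have "x \<notin> C i" if "i < k" "i \<noteq> j" for i
    using that assms disjoint by (auto simp: disjoint_family_on_def)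
  then have "sq_dist_to_mean x = (\<Sum>i<k. if i = j then (dist x (mean_point (C j)))\<^sup>2 else 0)"
    unfolding sq_dist_to_mean_def using assms by (intro sum.cong) (auto simp: indicator_def)
  then show ?thesis using assms by simp
qed

lemma sq_dist_to_mean_outlier: "x \<notin> inliers \<Longrightarrow> sq_dist_to_mean x = 0"
  by (auto simp: sq_dist_to_mean_def inliers_def intro: sum.neutral)

lemma sq_dist_to_mean_nonneg: "sq_dist_to_mean x \<ge> 0"
  unfolding sq_dist_to_mean_def by (intro sum_nonneg) auto

lemma dist_le_max_diam:
  assumes "j < k" "p \<in> C j" "q \<in> C j"
  shows "dist p q \<le> max_diam k C"
  unfolding max_diam_def
proof (rule Max_ge)
  have "{dist p q |p q. p \<in> C j \<and> q \<in> C j} = case_prod dist ` (C j \<times> C j)" for j by auto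
  then show "finite (\<Union>j<k. {dist p q |p q. p \<in> C j \<and> q \<in> C j})" using finite_cluster by auto
qed (use assms in auto)

lemma sq_dist_to_mean_le_max_diam: "sq_dist_to_mean x \<le> (max_diam k C)\<^sup>2"
proof (cases "x \<in> inliers")
  case True
  then obtain j where cluster: "j < k" "x \<in> C j" by (auto simp: inliers_def)
  have "mean_point (C j) \<in> cball x (max_diam k C)"
    using cluster finite_cluster cluster_nonempty dist_le_max_diam
    by (intro mean_point_in_convex) auto
  then show ?thesis using cluster by (simp add: sq_dist_to_mean_cluster power_mono)
qed (simp add: sq_dist_to_mean_outlier)

lemma sum_sq_dist_to_mean: "(\<Sum>p\<in>P. sq_dist_to_mean p) = inlier_cost"
  unfolding inlier_cost_def using finite_P inliers_subset sq_dist_to_mean_outlier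
  by (intro sum.mono_neutral_right) auto

lemma inlier_cost_le:
  assumes "\<And>j p. j < k \<Longrightarrow> p \<in> C j \<Longrightarrow> dist p (h j) = dist_set p H"
  shows "inlier_cost \<le> (\<Sum>p\<in>inliers. (dist_set p H)\<^sup>2)"
proof -
  have "inlier_cost = (\<Sum>j<k. \<Sum>p\<in>C j. (dist p (mean_point (C j)))\<^sup>2)"
    unfolding inlier_cost_def sum_inliers using sq_dist_to_mean_cluster by (intro sum.cong) auto
  also have "\<dots> \<le> (\<Sum>j<k. \<Sum>p\<in>C j. (dist p (h j))\<^sup>2)"
  proof (rule sum_mono)
    fix j assume "j \<in> {..<k}"
    then show "(\<Sum>p\<in>C j. (dist p (mean_point (C j)))\<^sup>2) \<le> (\<Sum>p\<in>C j. (dist p (h j))\<^sup>2)"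
      by (simp add: sum_dist_sq_eq_mean_point[OF finite_cluster, of j "h j"])
  qed
  also have "\<dots> = (\<Sum>p\<in>inliers. (dist_set p H)\<^sup>2)"
    unfolding sum_inliers using assms by (intro sum.cong) auto
  finally show ?thesis .
qed

lemma sum_inliers_dist_set_sq_le:
  assumes centers: "finite H" "H \<noteq> {}" and \<kappa>_pos: "\<kappa> > 0"
    and many: "\<And>j. j < k \<Longrightarrow> \<kappa> * real (card (C j)) \<le> real (length (filter (\<lambda>x. x \<in> C j) S))"
  shows "(\<Sum>p\<in>inliers. (dist_set p H)\<^sup>2)
    \<le> 2 * inlier_cost + 4 / \<kappa> * ((\<Sum>x\<leftarrow>S. sq_dist_to_mean x) + kmeans_cost S H)"
proof -
  let ?f = "\<lambda>x. sq_dist_to_mean x + (dist_set x H)\<^sup>2"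
  have f_nonneg: "0 \<le> ?f x" for x using sq_dist_to_mean_nonneg[of x] by simp
  have cluster: "(\<Sum>p\<in>C j. (dist_set p H)\<^sup>2)
      \<le> 2 * (\<Sum>p\<in>C j. sq_dist_to_mean p) + 4 / \<kappa> * (\<Sum>x\<leftarrow>filter (\<lambda>x. x \<in> C j) S. ?f x)"
    if "j < k" for j
  proof -
    have "(\<Sum>x\<leftarrow>filter (\<lambda>x. x \<in> C j) S. ?f x)
        = (\<Sum>x\<leftarrow>filter (\<lambda>x. x \<in> C j) S. (dist x (mean_point (C j)))\<^sup>2 + (dist_set x H)\<^sup>2)"
      using sq_dist_to_mean_cluster[OF that] by (intro arg_cong[where f = sum_list] map_cong) auto
    then show ?thesis
      using sum_dist_set_sq_le_sample[OF centers \<kappa>_pos many[OF that], of "mean_point (C j)"]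
      by (simp add: sq_dist_to_mean_cluster[OF that])
  qed
  have "(\<Sum>p\<in>inliers. (dist_set p H)\<^sup>2) \<le> (\<Sum>j<k. 2 * (\<Sum>p\<in>C j. sq_dist_to_mean p)
      + 4 / \<kappa> * (\<Sum>x\<leftarrow>filter (\<lambda>x. x \<in> C j) S. ?f x))"
    unfolding sum_inliers by (intro sum_mono cluster) simp
  also have "\<dots> = 2 * inlier_cost + 4 / \<kappa> * (\<Sum>j<k. \<Sum>x\<leftarrow>filter (\<lambda>x. x \<in> C j) S. ?f x)"
    unfolding inlier_cost_def sum_inliers by (simp only: sum.distrib sum_distrib_left)
  also have "(\<Sum>j<k. \<Sum>x\<leftarrow>filter (\<lambda>x. x \<in> C j) S. ?f x) \<le> (\<Sum>x\<leftarrow>S. ?f x)"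
    by (intro sum_sum_list_filter_disjoint_family_le disjoint f_nonneg) simp
  also have "\<dots> = (\<Sum>x\<leftarrow>S. sq_dist_to_mean x) + kmeans_cost S H"
    by (simp add: kmeans_cost_def sum_list_addf)
  finally show ?thesis using \<kappa>_pos by (simp add: mult_left_mono divide_right_mono)
qed

lemma kmeans_cost_c_approx_le_sample:
  assumes approx: "is_c_approx c (k + K) S H" and c_nonneg: "0 \<le> c"
    and few: "outlier_count S \<le> K"
  shows "kmeans_cost S H \<le> c * (\<Sum>x\<leftarrow>S. sq_dist_to_mean x)"
proof -
  let ?means = "(\<lambda>j. mean_point (C j)) ` {..<k}"
  let ?outliers = "set (filter (\<lambda>x. x \<notin> inliers) S)"
  have nonempty: "?means \<union> ?outliers \<noteq> {}" using k_pos by auto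
  have "card (?means \<union> ?outliers) \<le> card ?means + card ?outliers" by (rule card_Un_le)
  also have "\<dots> \<le> k + K"
    using card_image_le[of "{..<k}" "\<lambda>j. mean_point (C j)"] few[unfolded outlier_count_def]
      card_length[of "filter (\<lambda>x. x \<notin> inliers) S"] by simp
  finally have "kmeans_cost S H \<le> c * kmeans_cost S (?means \<union> ?outliers)"
    using nonempty by (intro kmeans_cost_c_approx_le[OF approx c_nonneg]) auto
  also have "kmeans_cost S (?means \<union> ?outliers) \<le> (\<Sum>x\<leftarrow>S. sq_dist_to_mean x)"
    unfolding kmeans_cost_def
  proof (rule sum_list_mono)
    fix x assume sampled: "x \<in> set S"
    show "(dist_set x (?means \<union> ?outliers))\<^sup>2 \<le> sq_dist_to_mean x"
    proof (cases "x \<in> inliers")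
      case True
      then obtain j where cluster: "j < k" "x \<in> C j" by (auto simp: inliers_def)
      then have "dist_set x (?means \<union> ?outliers) \<le> dist x (mean_point (C j))"
        using nonempty by (subst dist_set_eq_infdist) (auto intro: infdist_le)
      then show ?thesis
        using cluster nonempty
        by (simp add: sq_dist_to_mean_cluster power_mono dist_set_eq_infdist infdist_nonneg)
    next
      case False
      then show ?thesis
        using sampled nonempty by (simp add: sq_dist_to_mean_outlier dist_set_eq_infdist)
    qed
  qed
  finally show ?thesis using c_nonneg by (simp add: mult_left_mono)
qed

lemma trimmed_cost_le_if_representative:
  assumes rep: "representative \<delta> \<xi> K S" and "S \<noteq> []" and \<delta>_less_1: "\<delta> < 1"
    and approx: "is_c_approx c (k + K) S H" and c_nonneg: "0 \<le> c"
    and card_inliers_eq: "card inliers = card P - z"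
  defines "\<beta> \<equiv> (4 + 4 * c) * (1 + \<delta>) / (1 - \<delta>)"
  shows "trimmed_cost P z H
    \<le> (2 + \<beta>) * (inlier_cost / real (card inliers)) + \<beta> * \<xi> * (max_diam k C)\<^sup>2"
proof -
  let ?cost = "\<Sum>x\<leftarrow>S. sq_dist_to_mean x"
  define B where "B = inlier_cost + real (card inliers) * \<xi> * (max_diam k C)\<^sup>2"
  define \<rho> where "\<rho> = real (length S) / real (card P)"
  have \<rho>_pos: "\<rho> > 0" using \<open>S \<noteq> []\<close> card_P_pos by (simp add: \<rho>_def)
  have centers: "finite H" "H \<noteq> {}" using approx k_pos by (auto simp: is_c_approx_def)
  have "kmeans_cost S H \<le> c * ?cost"
    using rep
    by (intro kmeans_cost_c_approx_le_sample[OF approx c_nonneg]) (simp add: representative_def)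
  then have "?cost + kmeans_cost S H \<le> (1 + c) * ?cost" by (simp add: distrib_right)
  also have "?cost \<le> (1 + \<delta>) * (\<rho> * inlier_cost) + (max_diam k C)\<^sup>2 * cost_slack \<delta> \<xi> (length S)"
    using rep by (simp add: representative_def costly_def \<rho>_def)
  also have "\<dots> = (1 + \<delta>) * (\<rho> * B)"
    by (simp add: cost_slack_def B_def distrib_left flip: \<rho>_def)
  finally have sampled: "?cost + kmeans_cost S H \<le> (1 + c) * ((1 + \<delta>) * (\<rho> * B))"
    using c_nonneg by (simp add: mult_left_mono)
  have "(\<Sum>p\<in>inliers. (dist_set p H)\<^sup>2)
      \<le> 2 * inlier_cost + 4 / ((1 - \<delta>) * \<rho>) * (?cost + kmeans_cost S H)"
    using rep \<rho>_pos \<delta>_less_1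
    by (intro sum_inliers_dist_set_sq_le centers)
      (simp_all add: representative_def undersampled_def expected_count_def not_less
        mult.assoc flip: \<rho>_def)
  also have "\<dots> \<le> 2 * inlier_cost + 4 / ((1 - \<delta>) * \<rho>) * ((1 + c) * ((1 + \<delta>) * (\<rho> * B)))"
    using sampled \<rho>_pos \<delta>_less_1 by (intro add_left_mono mult_left_mono) auto
  also have "\<dots> = 2 * inlier_cost + \<beta> * B"
    using \<rho>_pos \<delta>_less_1 by (simp add: \<beta>_def field_simps)
  finally have "(\<Sum>p\<in>inliers. (dist_set p H)\<^sup>2) / real (card inliers)
      \<le> (2 * inlier_cost + \<beta> * B) / real (card inliers)"
    by (intro divide_right_mono) auto
  also have "\<dots> = (2 + \<beta>) * (inlier_cost / real (card inliers)) + \<beta> * \<xi> * (max_diam k C)\<^sup>2"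
    using card_inliers_pos by (simp add: B_def field_simps)
  finally show ?thesis
    using trimmed_cost_le[OF finite_P inliers_subset card_inliers_eq, of H] by simp
qed

subsection \<open>Failure probabilities\<close>

abbreviation sample_pmf :: "nat \<Rightarrow> 'a list pmf" where
  "sample_pmf m \<equiv> replicate_pmf m (pmf_of_set P)"

abbreviation sample_prob :: "nat \<Rightarrow> 'a list set \<Rightarrow> real" where
  "sample_prob m \<equiv> measure_pmf.prob (sample_pmf m)"

lemma length_sample: "S \<in> set_pmf (sample_pmf m) \<Longrightarrow> length S = m"
  by (simp add: set_replicate_pmf)

lemma prob_undersampled_le:
  assumes "0 \<le> \<delta>" "j < k"
  shows "sample_prob m {S. undersampled \<delta> j S} \<le> exp (- (\<delta>\<^sup>2 * expected_count m j / 2))"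
proof -
  have count: "real (length (filter (\<lambda>x. x \<in> C j) S)) = (\<Sum>x\<leftarrow>S. indicat_real (C j) x)" for S
    by (induction S) auto
  have "P \<inter> C j = C j" using cluster_subset[OF assms(2)] by blast
  then have mean: "real m * measure_pmf.expectation (pmf_of_set P) (indicat_real (C j))
      = expected_count m j"
    using finite_P P_nonempty by (simp add: measure_pmf_of_set expected_count_def)
  have "sample_prob m {S. undersampled \<delta> j S}
      \<le> sample_prob m {S. (\<Sum>x\<leftarrow>S. indicat_real (C j) x) < (1 - \<delta>) * expected_count m j}"
    by (rule prob_mono_on_set_pmf) (simp add: undersampled_def count length_sample)
  also have "\<dots> \<le> exp (- (\<delta>\<^sup>2 * expected_count m j / 2))"
    using prob_replicate_pmf_lower_tail[OF assms(1), of "pmf_of_set P" "indicat_real (C j)" m]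
    unfolding mean by simp
  finally show ?thesis .
qed

lemma prob_costly_le:
  assumes \<delta>_bounds: "0 \<le> \<delta>" "\<delta> \<le> 1"
  shows "sample_prob m {S. costly \<delta> \<xi> S} \<le> exp (- (\<delta> * cost_slack \<delta> \<xi> m))"
proof (cases "max_diam k C = 0")
  case True
  then have "sq_dist_to_mean x = 0" for x
    using sq_dist_to_mean_nonneg[of x] sq_dist_to_mean_le_max_diam[of x] by simp
  then show ?thesis using True by (simp add: costly_def inlier_cost_def)
next
  case False
  have mean: "real m * measure_pmf.expectation (pmf_of_set P) sq_dist_to_mean
      = real m / real (card P) * inlier_cost"
    using finite_P P_nonempty by (simp add: integral_pmf_of_set sum_sq_dist_to_mean)
  have "sample_prob m {S. costly \<delta> \<xi> S}
      \<le> sample_prob m {S. (1 + \<delta>) * (real m / real (card P) * inlier_cost)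
        + (max_diam k C)\<^sup>2 * cost_slack \<delta> \<xi> m < (\<Sum>x\<leftarrow>S. sq_dist_to_mean x)}"
    by (rule prob_mono_on_set_pmf) (simp add: costly_def length_sample)
  also have "\<dots> \<le> exp (- (\<delta> * cost_slack \<delta> \<xi> m))"
    using prob_replicate_pmf_upper_tail[OF \<delta>_bounds, of "(max_diam k C)\<^sup>2" "pmf_of_set P"
        sq_dist_to_mean m] False sq_dist_to_mean_nonneg sq_dist_to_mean_le_max_diam
    unfolding mean by simp
  finally show ?thesis .
qed

lemma prob_many_outliers_le:
  assumes \<eta>_bounds: "0 < \<eta>" "\<eta> < 1"
    and budget: "real m * (real (card (P - inliers)) / real (card P)) \<le> \<eta> * real K"
  shows "sample_prob m {S. K < outlier_count S} \<le> min \<eta> (1 / 2)"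
proof -
  define p where "p = measure_pmf.prob (pmf_of_set P) (- inliers)"
  have p_range: "p \<in> {0..1}" by (simp add: p_def)
  have "p = real (card (P - inliers)) / real (card P)"
    using finite_P P_nonempty by (simp add: p_def measure_pmf_of_set Diff_eq)
  then have mean: "real m * p \<le> \<eta> * real K" using budget by simp
  also have "\<dots> \<le> real K" using \<eta>_bounds by (simp add: mult_left_le_one_le)
  finally have "measure_pmf.prob (binomial_pmf m p) {K<..} \<le> min \<eta> (1 / 2)"
    using prob_binomial_pmf_greaterThan_le_half[OF p_range]
      prob_binomial_pmf_greaterThan_Markov[OF p_range _ mean] \<eta>_bounds by simp
  moreover have "binomial_pmf m p = map_pmf outlier_count (sample_pmf m)"
    using map_pmf_count_replicate_pmf[of "- inliers" m "pmf_of_set P"]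
    by (simp add: p_def outlier_count_def[abs_def])
  ultimately show ?thesis by (simp add: vimage_def)
qed

lemma prob_undersampled_le_budget:
  assumes \<eta>_bounds: "0 < \<eta>" "\<eta> < 1" and "0 \<le> \<delta>" "j < k"
    and size: "3 * ln (2 * real k / \<eta>) \<le> \<delta>\<^sup>2 * expected_count m j"
  shows "sample_prob m {S. undersampled \<delta> j S}
    \<le> (if k = 1 then \<eta> / 2 else \<eta> / (4 * real k))"
proof -
  define x where "x = 2 * real k / \<eta>"
  have x_ge: "2 * real k \<le> x" "2 \<le> x" using \<eta>_bounds k_pos by (auto simp: x_def field_simps)
  have "sample_prob m {S. undersampled \<delta> j S} \<le> exp (- (\<delta>\<^sup>2 * expected_count m j / 2))"
    using assms(3,4) by (rule prob_undersampled_le)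
  also have "\<dots> \<le> exp (- (3 / 2 * ln x))" using size by (simp add: x_def)
  also have "\<dots> = 1 / (x * sqrt x)" using x_ge by (intro exp_minus_three_halves_ln) simp
  also have "\<dots> \<le> (if k = 1 then 1 / (x * 1) else 1 / (x * 2))"
    using x_ge k_pos by (auto intro!: divide_left_mono mult_left_mono real_le_rsqrt)
  also have "\<dots> = (if k = 1 then \<eta> / 2 else \<eta> / (4 * real k))" by (simp add: x_def)
  finally show ?thesis .
qed

text \<open>If there is only one cluster, every sample point outside it is an outlier. Both events then
  bound the number of sample points in the cluster from above, so one of them contains the other.\<close>
lemma prob_undersampled_or_many_outliers_single_cluster:
  assumes "k = 1"
  shows "sample_prob m {S. undersampled \<delta> 0 S \<or> K < outlier_count S}
    \<le> max (sample_prob m {S. undersampled \<delta> 0 S})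
        (sample_prob m {S. K < outlier_count S})"
proof -
  have "x \<in> inliers \<longleftrightarrow> x \<in> C 0" for x
    using assms unfolding inliers_def by auto
  then have complement: "real (outlier_count S) = real m - real (length (filter (\<lambda>x. x \<in> C 0) S))"
    if "S \<in> set_pmf (sample_pmf m)" for S
    using sum_length_filter_compl[of "\<lambda>x. x \<in> C 0" S] length_sample[OF that]
    by (simp add: outlier_count_def)
  show ?thesis
  proof (cases "(1 - \<delta>) * expected_count m 0 \<le> real m - real K")
    case True
    then have "K < outlier_count S"
      if "S \<in> set_pmf (sample_pmf m)" "undersampled \<delta> 0 S" for S
      using that complement[OF that(1)] length_sample[OF that(1)] by (simp add: undersampled_def)
    then show ?thesis by (intro max.coboundedI2 prob_mono_on_set_pmf) auto
  next
    case False
    then have "undersampled \<delta> 0 S"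
      if "S \<in> set_pmf (sample_pmf m)" "K < outlier_count S" for S
      using that complement[OF that(1)] length_sample[OF that(1)] by (simp add: undersampled_def)
    then show ?thesis by (intro max.coboundedI1 prob_mono_on_set_pmf) auto
  qed
qed

lemma prob_undersampled_or_many_outliers_le:
  assumes \<eta>_bounds: "0 < \<eta>" "\<eta> < 1" and \<delta>_nonneg: "0 \<le> \<delta>"
    and size: "\<And>j. j < k \<Longrightarrow> 3 * ln (2 * real k / \<eta>) \<le> \<delta>\<^sup>2 * expected_count m j"
    and budget: "real m * (real (card (P - inliers)) / real (card P)) \<le> \<eta> * real K"
  shows "sample_prob m {S. (\<exists>j<k. undersampled \<delta> j S) \<or> K < outlier_count S}
    \<le> min \<eta> (1 / 2) + (\<eta> / 2 - \<eta> / (2 * real k))"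
proof -
  note undersampled = prob_undersampled_le_budget[OF \<eta>_bounds \<delta>_nonneg _ size]
  note many_outliers = prob_many_outliers_le[OF \<eta>_bounds budget]
  show ?thesis
  proof (cases "k = 1")
    case True
    then show ?thesis
      using prob_undersampled_or_many_outliers_single_cluster[OF True, of m \<delta> K] many_outliers
        undersampled[of 0] \<eta>_bounds by (auto simp: max_def min_def split: if_splits)
  next
    case False
    then have k_ge_2: "real k \<ge> 2" using k_pos by simp
    have "{S. (\<exists>j<k. undersampled \<delta> j S) \<or> K < outlier_count S}
        = (\<Union>j<k. {S. undersampled \<delta> j S}) \<union> {S. K < outlier_count S}" by auto
    then have "sample_prob m {S. (\<exists>j<k. undersampled \<delta> j S) \<or> K < outlier_count S}
        \<le> sample_prob m (\<Union>j<k. {S. undersampled \<delta> j S}) + sample_prob m {S. K < outlier_count S}"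
      by (simp add: measure_Un_le)
    also have "sample_prob m (\<Union>j<k. {S. undersampled \<delta> j S})
        \<le> (\<Sum>j<k. sample_prob m {S. undersampled \<delta> j S})"
      by (intro measure_pmf.finite_measure_subadditive_finite) auto
    also have "\<dots> \<le> real (card {..<k}) * (\<eta> / (4 * real k))"
      using undersampled False by (intro sum_bounded_above) auto
    also have "\<dots> \<le> \<eta> / 2 - \<eta> / (2 * real k)"
      using k_ge_2 \<eta>_bounds by (simp add: field_simps)
    finally show ?thesis using many_outliers by linarith
  qed
qed

lemma prob_representative_ge:
  assumes \<eta>_bounds: "0 < \<eta>" "\<eta> < 1" and \<delta>_bounds: "0 \<le> \<delta>" "\<delta> \<le> 1"
    and size: "\<And>j. j < k \<Longrightarrow> 3 * ln (2 * real k / \<eta>) \<le> \<delta>\<^sup>2 * expected_count m j"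
      "ln (2 * real k / \<eta>) \<le> \<delta> * cost_slack \<delta> \<xi> m"
    and budget: "real m * (real (card (P - inliers)) / real (card P)) \<le> \<eta> * real K"
  shows "sample_prob m {S. representative \<delta> \<xi> K S} \<ge> (1 - \<eta>) ^ 3"
proof -
  let ?unbalanced = "{S. (\<exists>j<k. undersampled \<delta> j S) \<or> K < outlier_count S}"
  have "sample_prob m {S. costly \<delta> \<xi> S} \<le> exp (- ln (2 * real k / \<eta>))"
    using prob_costly_le[OF \<delta>_bounds, of m \<xi>] size(2)
    by (meson exp_le_cancel_iff neg_le_iff_le order_trans)
  also have "\<dots> = \<eta> / (2 * real k)" using \<eta>_bounds k_pos by (simp add: exp_minus)
  finally have costly: "sample_prob m {S. costly \<delta> \<xi> S} \<le> \<eta> / (2 * real k)" .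
  have "- {S. representative \<delta> \<xi> K S} = ?unbalanced \<union> {S. costly \<delta> \<xi> S}"
    by (auto simp: representative_def)
  then have "sample_prob m (- {S. representative \<delta> \<xi> K S})
      \<le> sample_prob m ?unbalanced + sample_prob m {S. costly \<delta> \<xi> S}"
    by (simp add: measure_Un_le)
  also have "\<dots> \<le> min \<eta> (1 / 2) + (\<eta> / 2 - \<eta> / (2 * real k)) + \<eta> / (2 * real k)"
    using costly by (intro add_mono prob_undersampled_or_many_outliers_le \<eta>_bounds
        \<delta>_bounds(1) size(1) budget)
  finally show ?thesis
    using failure_budget_le[OF \<eta>_bounds]
      measure_pmf.prob_compl[of "{S. representative \<delta> \<xi> K S}" "sample_pmf m"]
    by (simp add: Compl_eq_Diff_UNIV)
qed

lemma mean_inlier_cost_le_trimmed_cost: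
  assumes opt: "\<And>H. finite H \<Longrightarrow> H \<noteq> {} \<Longrightarrow> card H \<le> k
      \<Longrightarrow> trimmed_cost P z (h ` {..<k}) \<le> trimmed_cost P z H"
    and inliers_opt: "(\<Sum>p\<in>inliers. (dist_set p (h ` {..<k}))\<^sup>2) / real (card inliers)
      = trimmed_cost P z (h ` {..<k})"
    and assign: "\<And>j p. j < k \<Longrightarrow> p \<in> C j \<Longrightarrow> dist p (h j) = dist_set p (h ` {..<k})"
  shows "inlier_cost / real (card inliers) \<le> trimmed_cost P z (mean_point ` C ` {..<k})"
proof -
  have "inlier_cost / real (card inliers) \<le> trimmed_cost P z (h ` {..<k})"
    unfolding inliers_opt[symmetric] using inlier_cost_le[OF assign]
    by (intro divide_right_mono) auto
  also have "\<dots> \<le> trimmed_cost P z (mean_point ` C ` {..<k})"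
  proof (rule opt)
    show "card (mean_point ` C ` {..<k}) \<le> k"
      using card_image_le[of "{..<k}" "mean_point \<circ> C"] by (simp add: image_comp)
  qed (use k_pos in auto)
  finally show ?thesis .
qed

end

locale significant_sample = disjoint_clusters P k C
  for P :: "'a::euclidean_space set" and k :: nat and C :: "nat \<Rightarrow> 'a set" +
  fixes \<epsilon>1 \<epsilon>2 \<eta> \<delta> \<xi> :: real and m K :: nat
  assumes cluster_significant: "j < k \<Longrightarrow> \<epsilon>1 / real k * real (card P) \<le> real (card (C j))"
    and outliers_significant: "real (card (P - inliers)) = \<epsilon>2 / real k * real (card P)"
    and \<epsilon>1_pos: "0 < \<epsilon>1" and \<eta>_bounds: "0 < \<eta>" "\<eta> < 1" and \<delta>_bounds: "0 < \<delta>" "\<delta> < 1"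
    and \<xi>_pos: "0 < \<xi>"
    and size_ge_cluster: "3 * real k / (\<delta>\<^sup>2 * \<epsilon>1) * ln (2 * real k / \<eta>) \<le> real m"
    and size_ge_cost: "real k / (2 * \<xi>\<^sup>2 * \<epsilon>1 * (1 - \<delta>)) * ln (2 * real k / \<eta>) \<le> real m"
    and extra_centers_ge: "(1 / \<eta>) * (\<epsilon>2 / real k) * real m \<le> real K"
begin

lemma ln_pos: "0 < ln (2 * real k / \<eta>)"
  using \<eta>_bounds k_pos by (simp add: field_simps)

lemma size_pos: "0 < m"
proof -
  have "0 < 3 * real k / (\<delta>\<^sup>2 * \<epsilon>1) * ln (2 * real k / \<eta>)"
    using \<delta>_bounds \<epsilon>1_pos k_pos ln_pos by simp
  then show ?thesis using size_ge_cluster by linarith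
qed

lemma card_inliers_ge: "\<epsilon>1 * real (card P) \<le> real (card inliers)"
proof -
  have "(\<Sum>j<k. \<epsilon>1 / real k * real (card P)) \<le> real (card inliers)"
    unfolding card_inliers of_nat_sum using cluster_significant by (intro sum_mono) auto
  then show ?thesis using k_pos by simp
qed

lemma expected_count_ge:
  assumes "j < k"
  shows "3 * ln (2 * real k / \<eta>) \<le> \<delta>\<^sup>2 * expected_count m j"
proof -
  have "3 * ln (2 * real k / \<eta>) \<le> \<delta>\<^sup>2 * (real m / real (card P) * (\<epsilon>1 / real k * real (card P)))"
    using size_ge_cluster \<epsilon>1_pos \<delta>_bounds k_pos card_P_pos by (simp add: field_simps)
  also have "\<dots> \<le> \<delta>\<^sup>2 * expected_count m j"
    unfolding expected_count_def using cluster_significant[OF assms] by (intro mult_left_mono) auto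
  finally show ?thesis .
qed

lemma k_mult_ln_le: "real k * ln (2 * real k / \<eta>) \<le> \<delta> * \<xi> * (\<epsilon>1 * real m)"
proof (cases "\<delta> \<le> 3 * \<xi>")
  case True
  have "3 * (real k * ln (2 * real k / \<eta>)) \<le> \<delta> * \<delta> * (\<epsilon>1 * real m)"
    using size_ge_cluster \<delta>_bounds \<epsilon>1_pos by (simp add: field_simps power2_eq_square)
  also have "\<dots> \<le> \<delta> * (3 * \<xi>) * (\<epsilon>1 * real m)"
    using True \<delta>_bounds \<epsilon>1_pos by (intro mult_right_mono mult_left_mono) auto
  finally show ?thesis by simp
next
  case False
  have "real k * ln (2 * real k / \<eta>) \<le> 2 * \<xi> * \<xi> * (\<epsilon>1 * real m) * (1 - \<delta>)"
    using size_ge_cost \<delta>_bounds \<epsilon>1_pos \<xi>_pos by (simp add: field_simps power2_eq_square)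
  also have "\<dots> \<le> 2 * \<xi> * \<xi> * (\<epsilon>1 * real m)"
    using \<delta>_bounds \<epsilon>1_pos \<xi>_pos by (intro mult_left_le) auto
  also have "\<dots> \<le> \<delta> * \<xi> * (\<epsilon>1 * real m)"
    using False \<xi>_pos \<epsilon>1_pos by (intro mult_right_mono) auto
  finally show ?thesis .
qed

lemma cost_slack_ge: "ln (2 * real k / \<eta>) \<le> \<delta> * cost_slack \<delta> \<xi> m"
proof -
  have "ln (2 * real k / \<eta>) \<le> real k * ln (2 * real k / \<eta>)"
    using ln_pos k_pos by (simp add: mult_le_cancel_right1)
  also note k_mult_ln_le
  also have "\<delta> * \<xi> * (\<epsilon>1 * real m) = \<delta> * (1 * (real m / real (card P) * (\<epsilon>1 * real (card P) * \<xi>)))"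
    using card_P_pos by simp
  also have "\<dots> \<le> \<delta> * cost_slack \<delta> \<xi> m"
    unfolding cost_slack_def using card_inliers_ge \<delta>_bounds \<epsilon>1_pos \<xi>_pos
    by (intro mult_left_mono mult_mono) auto
  finally show ?thesis .
qed

lemma prob_representative_samples_ge:
  "(1 - \<eta>) ^ 3 \<le> measure_pmf.prob (pmf_of_set (samples P m)) {S. representative \<delta> \<xi> K S}"
proof -
  have "real m * (real (card (P - inliers)) / real (card P)) \<le> \<eta> * real K"
    using mult_left_mono[OF extra_centers_ge, of \<eta>] \<eta>_bounds card_P_pos
    unfolding outliers_significant by (simp add: mult_ac)
  then have "(1 - \<eta>) ^ 3 \<le> sample_prob m {S. representative \<delta> \<xi> K S}"
    using \<eta>_bounds \<delta>_bounds by (intro prob_representative_ge expected_count_ge cost_slack_ge) auto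
  then show ?thesis by (simp add: replicate_pmf_of_set finite_P P_nonempty)
qed

theorem prob_trimmed_cost_le:
  fixes A :: "'a list \<Rightarrow> 'a set pmf" and c :: real
  assumes approx: "\<And>S H. S \<in> samples P m \<Longrightarrow> H \<in> set_pmf (A S) \<Longrightarrow> is_c_approx c (k + K) S H"
    and c_nonneg: "0 \<le> c" and card_inliers_eq: "card inliers = card P - z"
    and mean_cost_le: "inlier_cost / real (card inliers) \<le> opt"
  defines "\<beta> \<equiv> (4 + 4 * c) * (1 + \<delta>) / (1 - \<delta>)"
  shows "(1 - \<eta>) ^ 3 \<le> measure_pmf.prob (bind_pmf (pmf_of_set (samples P m)) A)
    {H. trimmed_cost P z H \<le> (2 + \<beta>) * opt + \<beta> * \<xi> * (max_diam k C)\<^sup>2}"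
proof -
  have "0 \<le> \<beta>" using c_nonneg \<delta>_bounds by (simp add: \<beta>_def)
  then have scaled_opt: "(2 + \<beta>) * (inlier_cost / real (card inliers)) \<le> (2 + \<beta>) * opt"
    using mean_cost_le by (intro mult_left_mono) auto
  have good_output: "trimmed_cost P z H \<le> (2 + \<beta>) * opt + \<beta> * \<xi> * (max_diam k C)\<^sup>2"
    if "S \<in> samples P m" "representative \<delta> \<xi> K S" "H \<in> set_pmf (A S)" for S H
  proof -
    have "S \<noteq> []" using that(1) size_pos by (auto simp: samples_def)
    then show ?thesis
      using trimmed_cost_le_if_representative[OF that(2) _ \<delta>_bounds(2) approx[OF that(1,3)]
          c_nonneg card_inliers_eq] scaled_opt
      unfolding \<beta>_def by linarith
  qed
  note prob_representative_samples_ge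
  also have "measure_pmf.prob (pmf_of_set (samples P m)) {S. representative \<delta> \<xi> K S}
      \<le> measure_pmf.prob (bind_pmf (pmf_of_set (samples P m)) A)
        {H. trimmed_cost P z H \<le> (2 + \<beta>) * opt + \<beta> * \<xi> * (max_diam k C)\<^sup>2}"
    using good_output
    by (intro prob_bind_pmf_ge) (simp add: finite_P P_nonempty finite_samples samples_nonempty)
  finally show ?thesis .
qed

end

lemma disjoint_clusters_if_significant:
  assumes "finite P" "P \<noteq> {}" and "0 < k" and \<epsilon>_pos: "0 < \<epsilon>"
    and sub: "(\<Union>j<k. C j) \<subseteq> P" and disj: "\<forall>i<k. \<forall>j<k. i \<noteq> j \<longrightarrow> C i \<inter> C j = {}"
    and signif: "\<forall>j<k. \<epsilon> / real k * real (card P) \<le> real (card (C j))"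
  shows "disjoint_clusters P k C"
proof
  fix j assume "j < k"
  show "C j \<subseteq> P" using sub \<open>j < k\<close> by auto
  have "0 < \<epsilon> / real k * real (card P)" using assms(1,2) \<epsilon>_pos \<open>j < k\<close> by (simp add: card_gt_0_iff)
  also have "\<dots> \<le> real (card (C j))" using signif \<open>j < k\<close> by simp
  finally show "C j \<noteq> {}" by auto
next
  show "disjoint_family_on C {..<k}" unfolding disjoint_family_on_def using disj by simp
qed fact+

theorem theorem3:
  fixes P :: "'a::euclidean_space set" and k z :: nat
    and \<epsilon>1 \<epsilon>2 \<eta> \<delta> \<xi> c :: real
    and h :: "nat \<Rightarrow> 'a" and C :: "nat \<Rightarrow> 'a set" and Popt :: "'a set"
    and A :: "'a list \<Rightarrow> 'a set pmf"
  assumes finP: "finite P"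
    and k_pos: "k \<ge> 1"
    and z_bounds: "0 < z" "z < card P"
    \<comment> \<open>an optimal solution (k centers h 0..h (k-1)) of k-means with z outliers\<close>
    and opt: "\<forall>H. finite H \<and> H \<noteq> {} \<and> card H \<le> k \<longrightarrow>
                 trimmed_cost P z (h ` {..<k}) \<le> trimmed_cost P z H"
    \<comment> \<open>its inlier set\<close>
    and Popt_sub: "Popt \<subseteq> P" and Popt_card: "card Popt = card P - z"
    and Popt_opt: "(\<Sum>p\<in>Popt. (dist_set p (h ` {..<k}))\<^sup>2) / real (card Popt)
                     = trimmed_cost P z (h ` {..<k})"
    \<comment> \<open>the optimal clusters\<close>
    and C_union: "(\<Union>j<k. C j) = Popt"
    and C_disj: "\<forall>i<k. \<forall>j<k. i \<noteq> j \<longrightarrow> C i \<inter> C j = {}"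
    and C_assign: "\<forall>j<k. \<forall>p\<in>C j. dist p (h j) = dist_set p (h ` {..<k})"
    \<comment> \<open>(epsilon1, epsilon2)-significance\<close>
    and eps_pos: "\<epsilon>1 > 0" "\<epsilon>2 > 0"
    and signif1: "\<forall>j<k. real (card (C j)) \<ge> \<epsilon>1 / real k * real (card P)"
    and signif2: "real z = \<epsilon>2 / real k * real (card P)"
    and params: "0 < \<eta>" "\<eta> < 1" "0 < \<delta>" "\<delta> < 1" "0 < \<xi>" "\<xi> < 1"
    and c_ge: "c \<ge> 1"
    \<comment> \<open>the c-approximation algorithm (possibly randomized)\<close>
    and A_approx: "\<forall>S \<in> samples P
          (nat \<lceil>max (3 * real k / (\<delta>\<^sup>2 * \<epsilon>1) * ln (2 * real k / \<eta>))
                    (real k / (2 * \<xi>\<^sup>2 * \<epsilon>1 * (1 - \<delta>)) * ln (2 * real k / \<eta>))\<rceil>).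
          \<forall>H \<in> set_pmf (A S). is_c_approx c (k + nat \<lceil>(1 / \<eta>) * (\<epsilon>2 / real k) * real (length S)\<rceil>) S H"
  shows "measure_pmf.prob
           (bind_pmf (pmf_of_set (samples P
              (nat \<lceil>max (3 * real k / (\<delta>\<^sup>2 * \<epsilon>1) * ln (2 * real k / \<eta>))
                        (real k / (2 * \<xi>\<^sup>2 * \<epsilon>1 * (1 - \<delta>)) * ln (2 * real k / \<eta>))\<rceil>))) A)
           {H. trimmed_cost P z H \<le>
                 (2 + (4 + 4 * c) * (1 + \<delta>) / (1 - \<delta>)) * trimmed_cost P z (mean_point ` C ` {..<k})
                 + ((4 + 4 * c) * (1 + \<delta>) / (1 - \<delta>)) * \<xi> * (max_diam k C)\<^sup>2}
         \<ge> (1 - \<eta>) ^ 3"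
proof -
  define m where "m = nat \<lceil>max (3 * real k / (\<delta>\<^sup>2 * \<epsilon>1) * ln (2 * real k / \<eta>))
                    (real k / (2 * \<xi>\<^sup>2 * \<epsilon>1 * (1 - \<delta>)) * ln (2 * real k / \<eta>))\<rceil>"
  define K where "K = nat \<lceil>(1 / \<eta>) * (\<epsilon>2 / real k) * real m\<rceil>"
  interpret disjoint_clusters P k C
    by (rule disjoint_clusters_if_significant[OF finP _ _ eps_pos(1) _ C_disj signif1])
      (use k_pos z_bounds C_union Popt_sub in auto)
  have inliers: "inliers = Popt" using C_union by (simp add: inliers_def)
  interpret significant_sample P k C \<epsilon>1 \<epsilon>2 \<eta> \<delta> \<xi> m K
  proof
    show "real (card (P - inliers)) = \<epsilon>2 / real k * real (card P)"
      using signif2 Popt_card z_bounds finite_inliers inliers_subset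
      by (simp add: card_Diff_subset inliers)
    show "3 * real k / (\<delta>\<^sup>2 * \<epsilon>1) * ln (2 * real k / \<eta>) \<le> real m"
      "real k / (2 * \<xi>\<^sup>2 * \<epsilon>1 * (1 - \<delta>)) * ln (2 * real k / \<eta>) \<le> real m"
      unfolding m_def by linarith+
    show "(1 / \<eta>) * (\<epsilon>2 / real k) * real m \<le> real K" unfolding K_def by linarith
  qed (use signif1 eps_pos params in auto)
  have "is_c_approx c (k + K) S H" if "S \<in> samples P m" "H \<in> set_pmf (A S)" for S H
    using that A_approx[folded m_def] by (auto simp: K_def samples_def)
  moreover have "inlier_cost / real (card inliers) \<le> trimmed_cost P z (mean_point ` C ` {..<k})"
    using opt Popt_opt C_assign
    by (intro mean_inlier_cost_le_trimmed_cost[of z h]) (auto simp: inliers)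
  ultimately show ?thesis
    unfolding m_def[symmetric] using c_ge Popt_card
    by (intro prob_trimmed_cost_le) (simp_all add: inliers)
qed

end
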